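(* Let $N\ge1$, let $a_1,\dots,a_N\in\mathbb{R}\setminus\{0\}$ satisfy $$\forall S\subseteq\{1,\dots,N\},\ S\ne\emptyset,\qquad \sum_{i\in S}a_i\ne0,$$ and let $(x_i^0)_{1\le i\le N}$ be a family of pairwise distinct points in the open upper half-plane $\mathbb{H}$. Let $T\in(0,+\infty)$ and assume that the solution $(x_1,\dots,x_N)$ of the point-vortex system in $\mathbb{H}$ with intensities $a_i$ and initial positions $x_i^0$ is defined on $[0,T)$. Let $$Q=\Big\{i\in\{1,\dots,N\}:\ \liminf_{t\to T}\operatorname{dist}(x_i(t),\partial\mathbb{H})=0\Big\},\qquad a=\sum_{i\in Q}|a_i|,\qquad A=\Big|\sum_{i\in Q}a_i\Big|.$$ If $Q\neq\emptyset$, then there do not exist a constant $C$ with $1\le C<\frac1{1-A/a}$ (where $\frac{1}{1-A/a}=+\infty$ if $A=a$) and a time $t_1\in[0,T)$ such that for every $t\in[t_1,T)$, $$\max_{k\in Q}\operatorname{dist}(x_k(t),\partial\mathbb{H})\le C\min_{k\in Q}\operatorname{dist}(x_k(t),\partial\mathbb{H}).$$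
   Context: For $x=(x_1,x_2)\in\mathbb{R}^2$ write $x^\perp=(-x_2,x_1)$, $\nabla^\perp=(-\partial_2,\partial_1)$, $\bar x=(x_1,-x_2)$; $\nabla_x$ is the gradient in the first variable. $\mathbb{H}=\{x_2>0\}$. The point-vortex system in $\mathbb{H}$ is $$\frac{\mathrm{d}}{\mathrm{d}t}x_i(t)=\sum_{\substack{j=1\\ j\ne i}}^N a_j\,\nabla_x^\perp G_{\mathbb{H}}(x_i(t),x_j(t))+\frac{a_i}{2}\nabla^\perp\widetilde\gamma_{\mathbb{H}}(x_i(t)),\qquad x_i(0)=x_i^0,$$ where a solution on $[0,T)$ has pairwise distinct $x_i(t)\in\mathbb{H}$ for each $t\in[0,T)$, and $$G_{\mathbb{H}}(x,y)=\frac1{2\pi}\ln\frac{|x-y|}{|x-\bar y|},\qquad \widetilde\gamma_{\mathbb{H}}(x)=-\frac1{2\pi}\ln(2x_2).$$ *)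

theory Defs
  imports "HOL-Analysis.Analysis"
begin

definition half_plane :: "(real^2) set" where
  "half_plane = {x. x $ 2 > 0}"

definition reflect :: "real^2 \<Rightarrow> real^2" where
  "reflect x = vector [x $ 1, - (x $ 2)]"

definition partial_deriv :: "2 \<Rightarrow> (real^2 \<Rightarrow> real) \<Rightarrow> real^2 \<Rightarrow> real" where
  "partial_deriv j f x = deriv (\<lambda>s. f (x + s *\<^sub>R axis j 1)) 0"

definition grad_perp :: "(real^2 \<Rightarrow> real) \<Rightarrow> real^2 \<Rightarrow> real^2" where
  "grad_perp f x = vector [- partial_deriv 2 f x, partial_deriv 1 f x]"

definition green_half_plane :: "real^2 \<Rightarrow> real^2 \<Rightarrow> real" where
  "green_half_plane x y = 1 / (2 * pi) * ln (norm (x - y) / norm (x - reflect y))"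

definition robin_half_plane :: "real^2 \<Rightarrow> real" where
  "robin_half_plane x = - (1 / (2 * pi)) * ln (2 * x $ 2)"

text \<open>Vortices are indexed by \<open>{1..N}\<close>, and the trajectories matter only on \<open>{0..<T}\<close>;
  at time \<open>0\<close> the derivative is one-sided.\<close>

definition point_vortex_solution ::
  "nat \<Rightarrow> (nat \<Rightarrow> real) \<Rightarrow> (nat \<Rightarrow> real^2) \<Rightarrow> real \<Rightarrow> (nat \<Rightarrow> real \<Rightarrow> real^2) \<Rightarrow> bool" where
  "point_vortex_solution N a x0 T x \<longleftrightarrow>
     (\<forall>i\<in>{1..N}. x i 0 = x0 i) \<and>
     (\<forall>t\<in>{0..<T}. (\<forall>i\<in>{1..N}. x i t \<in> half_plane) \<and> inj_on (\<lambda>i. x i t) {1..N}) \<and>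
     (\<forall>t\<in>{0..<T}. \<forall>i\<in>{1..N}.
        (x i has_vector_derivative
           ((\<Sum>j\<in>{1..N} - {i}. a j *\<^sub>R grad_perp (\<lambda>z. green_half_plane z (x j t)) (x i t))
            + (a i / 2) *\<^sub>R grad_perp robin_half_plane (x i t)))
        (at t within {0..<T}))"

definition boundary_dist :: "real^2 \<Rightarrow> real" where
  "boundary_dist x = infdist x (frontier half_plane)"

definition boundary_vortices :: "nat \<Rightarrow> real \<Rightarrow> (nat \<Rightarrow> real \<Rightarrow> real^2) \<Rightarrow> nat set" where
  "boundary_vortices N T x =
     {i \<in> {1..N}. Liminf (at_left T) (\<lambda>t. ereal (boundary_dist (x i t))) = 0}"

text \<open>The case split is needed because division by zero yields \<open>0\<close> on the reals.\<close>

definition ratio_threshold :: "real \<Rightarrow> real \<Rightarrow> ereal" where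
  "ratio_threshold A s = (if A = s then \<infinity> else ereal (1 / (1 - A / s)))"

end

theory Submission imports Defs begin

text \<open>
  Why the theorem holds.  Write \<open>y\<^sub>i\<close> for the height of the \<open>i\<close>-th vortex, which is its distance
  to the boundary.  Only the other vortices move a vortex vertically, and the interaction is
  antisymmetric, so in the derivative of \<open>\<Sum>i\<in>Q. a\<^sub>i y\<^sub>i\<close> the exchanges inside \<open>Q\<close> cancel:
  only the action of the vortices outside \<open>Q\<close> on those in \<open>Q\<close> is left
  (\<open>sum_antisymmetric_exchange\<close>).

  A vortex outside \<open>Q\<close> keeps its height above some \<open>c > 0\<close> near the final time.  Its effect on the
  height of a vortex at height \<open>y \<le> c / 2\<close> is at most a constant times \<open>y\<close>, because the
  boundary is a streamline of its flow (\<open>lift_kernel_bound\<close>).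

  Suppose the heights in \<open>Q\<close> are comparable with a constant \<open>C\<close> below the threshold.  Then
  positive and negative intensities cannot balance: taken with the sign of \<open>\<Sum>i\<in>Q. a\<^sub>i\<close>, the
  weighted sum, now called \<open>F\<close>, is at least a positive multiple of the largest height in \<open>Q\<close>
  (\<open>weighted_sum_ge_Max\<close>).  This is
  exactly where the value \<open>1 / (1 - A / a)\<close> enters, and where \<open>A > 0\<close>, i.e. the hypothesis on
  partial sums, is used.  Hence as soon as \<open>F\<close> is small, all heights in \<open>Q\<close> are small and
  \<open>F' \<ge> - K F\<close> for a constant \<open>K\<close>; so \<open>F\<close> stays away from zero on a bounded time interval
  (\<open>gronwall_below_level\<close>).  Yet every height in \<open>Q\<close> comes arbitrarily close to zero, and
  comparability drags \<open>F\<close> to zero with it, a contradiction.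
\<close>

section \<open>Distance to the boundary\<close>

lemma frontier_half_plane: "frontier half_plane = {x. x $ 2 = 0}"
proof -
  have "half_plane = {x :: real^2. axis 2 1 \<bullet> x > 0}"
    by (auto simp: half_plane_def inner_axis')
  moreover have "frontier {x :: real^2. axis 2 1 \<bullet> x > 0} = {x. axis 2 1 \<bullet> x = 0}"
    by (rule frontier_halfspace_gt) (simp add: axis_eq_0_iff)
  ultimately show ?thesis
    by (simp add: inner_axis')
qed

lemma boundary_dist_eq:
  assumes "x \<in> half_plane"
  shows "boundary_dist x = x $ 2"
proof -
  let ?p = "vector [x $ 1, 0] :: real^2"
  have p: "?p \<in> frontier half_plane"
    by (simp add: frontier_half_plane)
  have pos: "x $ 2 > 0" using assms by (simp add: half_plane_def)
  have "dist x ?p = x $ 2"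
    using pos by (simp add: dist_norm norm_vec_def L2_set_def UNIV_2)
  then have "infdist x (frontier half_plane) \<le> x $ 2"
    using infdist_le[OF p, of x] by simp
  moreover have "x $ 2 \<le> infdist x (frontier half_plane)"
  proof -
    have "x $ 2 \<le> dist x y" if "y \<in> frontier half_plane" for y
      using that component_le_norm_cart[of "x - y" 2] pos
      by (simp add: frontier_half_plane dist_norm)
    then show ?thesis
      using p unfolding infdist_def by (auto intro!: cINF_greatest)
  qed
  ultimately show ?thesis by (simp add: boundary_dist_def)
qed

section \<open>Vertical velocity\<close>

text \<open>
  The value of \<open>\<partial>\<^sub>1 G(x, y)\<close>, by \<open>deriv_green_horizontal\<close> below: the vertical velocity that a unit
  vortex at \<open>y\<close>, together with its mirror image, induces at \<open>x\<close>.
\<close>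

definition lift_kernel :: "real^2 \<Rightarrow> real^2 \<Rightarrow> real" where
  "lift_kernel x y = 1 / (2 * pi) * (x $ 1 - y $ 1) *
     (1 / ((x $ 1 - y $ 1)\<^sup>2 + (x $ 2 - y $ 2)\<^sup>2) - 1 / ((x $ 1 - y $ 1)\<^sup>2 + (x $ 2 + y $ 2)\<^sup>2))"

lemma lift_kernel_antisym: "lift_kernel y x = - lift_kernel x y"
proof -
  have "y $ 1 - x $ 1 = - (x $ 1 - y $ 1)" "y $ 2 - x $ 2 = - (x $ 2 - y $ 2)"
    by simp_all
  then show ?thesis
    unfolding lift_kernel_def
    by (simp only: power2_minus add.commute[of "y $ 2"] mult_minus_left mult_minus_right)
qed

lemma norm_real2: "norm (x :: real^2) = sqrt ((x $ 1)\<^sup>2 + (x $ 2)\<^sup>2)"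
  by (simp add: norm_vec_def L2_set_def UNIV_2)

lemma deriv_green_horizontal:
  assumes "x \<in> half_plane" "y \<in> half_plane" "x \<noteq> y"
  shows "partial_deriv 1 (\<lambda>z. green_half_plane z y) x = lift_kernel x y"
proof -
  define u v w where "u = x $ 1 - y $ 1" and "v = x $ 2 - y $ 2" and "w = x $ 2 + y $ 2"
  have w: "w > 0" using assms by (simp add: w_def half_plane_def)
  have uv: "u \<noteq> 0 \<or> v \<noteq> 0" using assms(3) by (auto simp: u_def v_def vec_eq_iff forall_2)
  have pos: "u\<^sup>2 + v\<^sup>2 > 0" "u\<^sup>2 + w\<^sup>2 > 0"
    using w uv by (auto simp: sum_power2_gt_zero_iff)
  have green: "green_half_plane (x + s *\<^sub>R axis 1 1) y
      = 1 / (2 * pi) * ln (sqrt ((u + s)\<^sup>2 + v\<^sup>2) / sqrt ((u + s)\<^sup>2 + w\<^sup>2))" for s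
    by (simp add: green_half_plane_def norm_real2 reflect_def axis_def u_def v_def w_def
        algebra_simps)
  have "((\<lambda>s. 1 / (2 * pi) * ln (sqrt ((u + s)\<^sup>2 + v\<^sup>2) / sqrt ((u + s)\<^sup>2 + w\<^sup>2)))
      has_real_derivative 1 / (2 * pi) * (u / (u\<^sup>2 + v\<^sup>2) - u / (u\<^sup>2 + w\<^sup>2))) (at 0)"
  proof -
    have "((\<lambda>s. 1 / (2 * pi) * (1 / 2 * ln ((u + s)\<^sup>2 + v\<^sup>2) - 1 / 2 * ln ((u + s)\<^sup>2 + w\<^sup>2)))
      has_real_derivative 1 / (2 * pi) * (u / (u\<^sup>2 + v\<^sup>2) - u / (u\<^sup>2 + w\<^sup>2))) (at 0)"
      using pos by (auto intro!: derivative_eq_intros simp: divide_simps)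
    moreover have "ln (sqrt ((u + s)\<^sup>2 + v\<^sup>2) / sqrt ((u + s)\<^sup>2 + w\<^sup>2))
        = 1 / 2 * ln ((u + s)\<^sup>2 + v\<^sup>2) - 1 / 2 * ln ((u + s)\<^sup>2 + w\<^sup>2)"
      if "(u + s)\<^sup>2 + v\<^sup>2 > 0" for s
    proof -
      have "(u + s)\<^sup>2 + w\<^sup>2 > 0" using w by (simp add: sum_power2_gt_zero_iff)
      moreover have "ln (sqrt p / sqrt q) = 1 / 2 * ln p - 1 / 2 * ln q" if "p > 0" "q > 0" for p q
        using that by (simp add: ln_div ln_sqrt)
      ultimately show ?thesis using that by blast
    qed
    moreover have "\<forall>\<^sub>F s in nhds 0. (u + s)\<^sup>2 + v\<^sup>2 > 0"
    proof -
      have "((\<lambda>s. (u + s)\<^sup>2 + v\<^sup>2) \<longlongrightarrow> (u + 0)\<^sup>2 + v\<^sup>2) (nhds 0)"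
        by (intro tendsto_intros filterlim_ident)
      then show ?thesis using pos(1) by (auto dest: order_tendstoD(1))
    qed
    ultimately show ?thesis
      by (subst DERIV_cong_ev[OF refl _ refl]) (auto elim!: eventually_mono)
  qed
  then show ?thesis
    unfolding partial_deriv_def green lift_kernel_def u_def[symmetric] v_def[symmetric] w_def[symmetric]
    by (subst DERIV_imp_deriv) (auto simp: algebra_simps)
qed

text \<open>
  The vortex at \<open>y\<close> and its mirror image nearly cancel at a point \<open>x\<close> close to the boundary: the
  difference of the two inverse squared distances has numerator \<open>4 x\<^sub>2 y\<^sub>2\<close>, which supplies the
  factor \<open>x\<^sub>2\<close>.  The factors \<open>x\<^sub>1 - y\<^sub>1\<close> and \<open>y\<^sub>2\<close> are absorbed by the squared distance to
  the image, and the distance to \<open>y\<close> itself is at least \<open>c / 2\<close>.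
\<close>

lemma lift_kernel_bound:
  assumes "x \<in> half_plane" "c > 0" "c \<le> y $ 2" "x $ 2 \<le> c / 2"
  shows "\<bar>lift_kernel x y\<bar> \<le> 8 / c\<^sup>2 * x $ 2"
proof -
  define u D E where "u = x $ 1 - y $ 1" and "D = u\<^sup>2 + (x $ 2 - y $ 2)\<^sup>2"
    and "E = u\<^sup>2 + (x $ 2 + y $ 2)\<^sup>2"
  have x2: "x $ 2 > 0" using assms(1) by (simp add: half_plane_def)
  have y2: "y $ 2 > 0" using assms by simp
  have "(c / 2)\<^sup>2 \<le> (y $ 2 - x $ 2)\<^sup>2"
    using assms by (intro power_mono) auto
  then have D: "c\<^sup>2 / 4 \<le> D"
    unfolding D_def by (simp add: power2_commute power_divide add_increasing)
  then have D0: "D > 0" using assms(2) by (smt (verit) divide_pos_pos zero_less_power)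
  have E0: "E > 0" unfolding E_def using x2 y2 by (simp add: sum_power2_gt_zero_iff)
  have uy: "\<bar>u\<bar> * y $ 2 \<le> E"
  proof -
    have "2 * (\<bar>u\<bar> * y $ 2) \<le> u\<^sup>2 + (y $ 2)\<^sup>2"
      using sum_squares_bound[of "\<bar>u\<bar>" "y $ 2"] by simp
    also have "(y $ 2)\<^sup>2 \<le> (x $ 2 + y $ 2)\<^sup>2"
      using x2 y2 by (intro power_mono) auto
    finally have "2 * (\<bar>u\<bar> * y $ 2) \<le> E" by (simp add: E_def)
    moreover have "0 \<le> \<bar>u\<bar> * y $ 2" using y2 by simp
    ultimately show ?thesis by linarith
  qed
  have "E - D = 4 * x $ 2 * y $ 2"
    by (simp add: D_def E_def power2_eq_square algebra_simps)
  then have "1 / D - 1 / E = 4 * x $ 2 * y $ 2 / (D * E)"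
    using D0 E0 by (simp add: field_simps)
  then have "lift_kernel x y = 1 / (2 * pi) * u * (4 * x $ 2 * y $ 2 / (D * E))"
    by (simp add: lift_kernel_def D_def E_def u_def)
  then have "\<bar>lift_kernel x y\<bar> = 1 / (2 * pi) * \<bar>u\<bar> * (4 * x $ 2 * y $ 2 / (D * E))"
    using x2 y2 D0 E0 by (simp only: abs_mult) simp
  also have "\<dots> = 2 * x $ 2 / (pi * D) * (\<bar>u\<bar> * y $ 2 / E)"
    by (simp add: mult.assoc mult.left_commute)
  also have "\<dots> \<le> 2 * x $ 2 / (pi * D) * 1"
    using uy E0 D0 x2 by (intro mult_left_mono) auto
  also have "\<dots> \<le> 2 * x $ 2 / (1 * (c\<^sup>2 / 4))"
    using D assms(2) x2 pi_gt3 D0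
    by (simp only: mult_1_right, intro divide_left_mono mult_mono mult_pos_pos) auto
  finally show ?thesis by (simp add: field_simps)
qed

lemma height_has_derivative:
  assumes sol: "point_vortex_solution N a x0 T x"
    and t: "t \<in> {0..<T}" and i: "i \<in> {1..N}"
  shows "((\<lambda>t. x i t $ 2) has_real_derivative (\<Sum>j\<in>{1..N}. a j * lift_kernel (x i t) (x j t)))
           (at t within {0..<T})"
proof -
  define V where "V = (\<Sum>j\<in>{1..N} - {i}. a j *\<^sub>R grad_perp (\<lambda>z. green_half_plane z (x j t)) (x i t))
            + (a i / 2) *\<^sub>R grad_perp robin_half_plane (x i t)"
  have "(x i has_vector_derivative V) (at t within {0..<T})"
    using sol t i unfolding point_vortex_solution_def V_def by blast
  then have "((\<lambda>t. x i t $ 2) has_vector_derivative V $ 2) (at t within {0..<T})"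
    by (rule bounded_linear.has_vector_derivative[OF bounded_linear_vec_nth])
  moreover have "V $ 2 = (\<Sum>j\<in>{1..N}. a j * lift_kernel (x i t) (x j t))"
  proof -
    have "grad_perp robin_half_plane z $ 2 = 0" for z
      by (simp add: grad_perp_def partial_deriv_def robin_half_plane_def axis_def)
    moreover have "grad_perp (\<lambda>z. green_half_plane z (x j t)) (x i t) $ 2
        = lift_kernel (x i t) (x j t)" if j: "j \<in> {1..N} - {i}" for j
    proof -
      have inj: "inj_on (\<lambda>i. x i t) {1..N}" and hp: "\<forall>i\<in>{1..N}. x i t \<in> half_plane"
        using sol t unfolding point_vortex_solution_def by blast+
      have "x i t \<noteq> x j t" using inj_onD[OF inj, of i j] i j by blast
      then show ?thesis
        using deriv_green_horizontal[of "x i t" "x j t"] hp i j by (simp add: grad_perp_def)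
    qed
    ultimately have "V $ 2 = (\<Sum>j\<in>{1..N} - {i}. a j * lift_kernel (x i t) (x j t))"
      by (simp add: V_def sum_component)
    also have "\<dots> = (\<Sum>j\<in>{1..N}. a j * lift_kernel (x i t) (x j t))"
      using i by (subst (2) sum.remove[of _ i]) (auto simp: lift_kernel_def)
    finally show ?thesis .
  qed
  ultimately show ?thesis
    by (simp add: has_real_derivative_iff_has_vector_derivative)
qed

section \<open>Weighted sums and a differential inequality\<close>

lemma sum_antisymmetric_exchange:
  fixes a :: "'i \<Rightarrow> real" and g :: "'i \<Rightarrow> 'i \<Rightarrow> real"
  assumes "finite V" "Q \<subseteq> V" and anti: "\<And>i j. g j i = - g i j"
  shows "(\<Sum>i\<in>Q. a i * (\<Sum>j\<in>V. a j * g i j)) = (\<Sum>i\<in>Q. a i * (\<Sum>j\<in>V - Q. a j * g i j))"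
proof -
  let ?S = "\<Sum>i\<in>Q. \<Sum>j\<in>Q. a i * a j * g i j"
  have "?S = (\<Sum>i\<in>Q. \<Sum>j\<in>Q. a j * a i * g j i)" by (rule sum.swap)
  also have "\<dots> = (\<Sum>i\<in>Q. \<Sum>j\<in>Q. - (a i * a j * g i j))"
    by (intro sum.cong refl, subst anti) simp
  also have "\<dots> = - ?S" by (simp add: sum_negf)
  finally have "?S = 0" by simp
  moreover have "(\<Sum>i\<in>Q. a i * (\<Sum>j\<in>V. a j * g i j))
      = (\<Sum>i\<in>Q. a i * (\<Sum>j\<in>V - Q. a j * g i j)) + ?S"
    by (subst sum.subset_diff[OF assms(2,1)])
      (simp add: sum.distrib distrib_left sum_distrib_left mult.assoc)
  ultimately show ?thesis by simp
qed

text \<open>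
  Replacing every height by the largest one, \<open>M\<close>, turns the weighted sum into \<open>(\<Sum>i\<in>Q. b i) * M\<close>.
  Each height is between \<open>M / C\<close> and \<open>M\<close>, so the error is at most
  \<open>(\<Sum>i\<in>Q. \<bar>b i\<bar>) * (1 - 1 / C) * M\<close>.
\<close>

lemma weighted_sum_ge_Max:
  fixes b y :: "'i \<Rightarrow> real"
  assumes "C > 0" and bounds: "\<And>i. i \<in> Q \<Longrightarrow> M / C \<le> y i \<and> y i \<le> M"
  shows "((\<Sum>i\<in>Q. b i) - (\<Sum>i\<in>Q. \<bar>b i\<bar>) * (1 - 1 / C)) * M \<le> (\<Sum>i\<in>Q. b i * y i)"
proof -
  have "b i * M - \<bar>b i\<bar> * ((1 - 1 / C) * M) \<le> b i * y i" if "i \<in> Q" for i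
  proof -
    have "b i * (M - y i) \<le> \<bar>b i\<bar> * (M - y i)"
      using bounds[OF that] by (intro mult_right_mono) auto
    also have "\<dots> \<le> \<bar>b i\<bar> * ((1 - 1 / C) * M)"
      using bounds[OF that] by (intro mult_left_mono) (auto simp: algebra_simps)
    finally show ?thesis by (simp add: algebra_simps)
  qed
  then have "(\<Sum>i\<in>Q. b i * M - \<bar>b i\<bar> * ((1 - 1 / C) * M)) \<le> (\<Sum>i\<in>Q. b i * y i)"
    by (rule sum_mono)
  then show ?thesis
    by (simp add: sum_subtractf sum_distrib_right[symmetric] left_diff_distrib mult.assoc)
qed

text \<open>
  The differential inequality is only available while \<open>F\<close> is below the level \<open>e\<close>.  This suffices:
  if \<open>G s = F s * exp (K * (s - t1))\<close> falls below \<open>min (F t1) e\<close>, then since the last time when it had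
  that value \<open>F\<close> has been below \<open>e\<close>, so \<open>G\<close> has not decreased.
\<close>

lemma gronwall_below_level:
  fixes F F' :: "real \<Rightarrow> real"
  assumes "t1 \<le> t" "K \<ge> 0" "e \<ge> 0"
    and der: "\<And>s. s \<in> {t1..t} \<Longrightarrow> (F has_real_derivative F' s) (at s within {t1..t})"
    and ineq: "\<And>s. s \<in> {t1..t} \<Longrightarrow> F s < e \<Longrightarrow> F' s \<ge> - K * F s"
  shows "min (F t1) e * exp (- K * (t - t1)) \<le> F t"
proof -
  define G G' where "G s = F s * exp (K * (s - t1))"
    and "G' s = (F' s + K * F s) * exp (K * (s - t1))" for s
  define m where "m = min (F t1) e"
  have derG: "(G has_real_derivative G' s) (at s within {t1..t})" if "s \<in> {t1..t}" for s
    unfolding G_def G'_def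
    by (auto intro!: derivative_eq_intros der[OF that] simp: algebra_simps)
  have contG: "continuous_on {t1..t} G"
    using derG by (rule DERIV_continuous_on)
  have "m \<le> G t"
  proof (rule ccontr)
    assume "\<not> m \<le> G t"
    then have lt: "G t < m" by simp
    let ?B = "{t1..t} \<inter> G -` {m..}"
    have "closed ?B"
      using contG by (rule continuous_closed_preimage) auto
    moreover have "bounded ?B"
      by (rule bounded_subset[OF bounded_closed_interval]) auto
    ultimately have "compact ?B" by (simp add: compact_eq_bounded_closed)
    moreover have "t1 \<in> ?B" using assms(1) by (simp add: G_def m_def)
    ultimately obtain s where s: "s \<in> ?B" and last: "\<And>r. r \<in> ?B \<Longrightarrow> r \<le> s"
      using compact_attains_sup[of ?B] by blast
    have st: "s < t" using s lt by (cases "s = t") auto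
    have "\<exists>z\<in>{s<..<t}. G t - G s = (\<lambda>h. G' z * h) (t - s)"
    proof (rule mvt_simple[OF st])
      fix r assume "s \<le> r" "r \<le> t"
      then have "(G has_real_derivative G' r) (at r within {s..t})"
        using s by (intro DERIV_subset[OF derG]) auto
      then show "(G has_derivative (\<lambda>h. G' r * h)) (at r within {s..t})"
        by (simp add: has_field_derivative_def)
    qed
    then obtain z where z: "z \<in> {s<..<t}" and eq: "G t - G s = G' z * (t - s)" by auto
    have zt: "z \<in> {t1..t}" using z s by auto
    then have "G z < m" using last[of z] z by force
    then have "G z < e" by (simp add: m_def)
    have "F z < e"
    proof (cases "F z \<ge> 0")
      case True
      have "1 \<le> exp (K * (z - t1))" using zt assms(2) by simp
      then have "F z \<le> G z" unfolding G_def using True by (simp add: mult_le_cancel_left1)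
      then show ?thesis using \<open>G z < e\<close> by simp
    next
      case False
      then show ?thesis using assms(3) by simp
    qed
    then have "G' z \<ge> 0" using ineq[OF zt] by (simp add: G'_def)
    then have "G s \<le> G t" using eq st by (smt (verit) mult_nonneg_nonneg)
    then show False using s lt by simp
  qed
  then have "m * exp (- K * (t - t1)) \<le> G t * exp (- K * (t - t1))"
    by (rule mult_right_mono) simp
  also have "\<dots> = F t" by (simp add: G_def mult.assoc flip: exp_add)
  finally show ?thesis by (simp add: m_def)
qed

section \<open>The theorem\<close>

theorem theoremB2:
  fixes N :: nat and a :: "nat \<Rightarrow> real" and x0 :: "nat \<Rightarrow> real^2"
    and T :: real and x :: "nat \<Rightarrow> real \<Rightarrow> real^2" and Q :: "nat set" and a_tot A :: real
  assumes "N \<ge> 1"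
    and "\<forall>i\<in>{1..N}. a i \<noteq> 0"
    and "\<forall>S. S \<subseteq> {1..N} \<and> S \<noteq> {} \<longrightarrow> (\<Sum>i\<in>S. a i) \<noteq> 0"
    and "\<forall>i\<in>{1..N}. x0 i \<in> half_plane"
    and "inj_on x0 {1..N}"
    and "0 < T"
    and "point_vortex_solution N a x0 T x"
    and "Q = boundary_vortices N T x"
    and "a_tot = (\<Sum>i\<in>Q. \<bar>a i\<bar>)"
    and "A = \<bar>\<Sum>i\<in>Q. a i\<bar>"
    and "Q \<noteq> {}"
  shows "\<not> (\<exists>C t1. 1 \<le> C \<and> ereal C < ratio_threshold A a_tot \<and> t1 \<in> {0..<T} \<and>
            (\<forall>t\<in>{t1..<T}. Max ((\<lambda>k. boundary_dist (x k t)) ` Q)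
                          \<le> C * Min ((\<lambda>k. boundary_dist (x k t)) ` Q)))"
proof
  let ?V = "{1..N}"
  let ?h = "\<lambda>i t. x i t $ 2"
  assume "\<exists>C t1. 1 \<le> C \<and> ereal C < ratio_threshold A a_tot \<and> t1 \<in> {0..<T} \<and>
            (\<forall>t\<in>{t1..<T}. Max ((\<lambda>k. boundary_dist (x k t)) ` Q)
                          \<le> C * Min ((\<lambda>k. boundary_dist (x k t)) ` Q))"
  then obtain C t0 where C: "1 \<le> C" "ereal C < ratio_threshold A a_tot" and t0: "t0 \<in> {0..<T}"
    and comp: "\<And>t. t \<in> {t0..<T} \<Longrightarrow> Max ((\<lambda>k. boundary_dist (x k t)) ` Q)
                          \<le> C * Min ((\<lambda>k. boundary_dist (x k t)) ` Q)"
    by blast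
  note sol = assms(7)
  have QV: "Q \<subseteq> ?V" using assms(8) by (auto simp: boundary_vortices_def)
  then have finQ: "finite Q" by (rule finite_subset) simp
  have hp: "x i t \<in> half_plane" if "i \<in> ?V" "t \<in> {0..<T}" for i t
    using sol that unfolding point_vortex_solution_def by blast
  have bd: "boundary_dist (x i t) = ?h i t" and hpos: "?h i t > 0"
    if "i \<in> ?V" "t \<in> {0..<T}" for i t
    using boundary_dist_eq hp[OF that] by (auto simp: half_plane_def)

  \<comment> \<open>The vortices outside \<open>Q\<close> stay above a common height near the final time.\<close>
  have "\<exists>c>0. \<forall>\<^sub>F t in at_left T. c \<le> boundary_dist (x j t)" if j: "j \<in> ?V - Q" for j
  proof -
    let ?L = "Liminf (at_left T) (\<lambda>t. ereal (boundary_dist (x j t)))"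
    have "0 \<le> ?L"
      by (rule Liminf_bounded) (simp add: boundary_dist_def infdist_nonneg)
    moreover have "?L \<noteq> 0" using j assms(8) by (auto simp: boundary_vortices_def)
    ultimately have "0 < ?L" by simp
    then obtain r :: real where r: "0 < ereal r" "ereal r < ?L"
      using ereal_dense2 by blast
    from r(2) have "\<forall>\<^sub>F t in at_left T. ereal r < ereal (boundary_dist (x j t))"
      by (rule less_LiminfD)
    then show ?thesis
      using r(1) by (intro exI[of _ r]) (auto elim: eventually_mono)
  qed
  then obtain cj where cj: "\<And>j. j \<in> ?V - Q \<Longrightarrow> cj j > 0"
      "\<And>j. j \<in> ?V - Q \<Longrightarrow> \<forall>\<^sub>F t in at_left T. cj j \<le> boundary_dist (x j t)"
    by metis
  define c where "c = Min (insert 1 (cj ` (?V - Q)))"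
  have c0: "c > 0" unfolding c_def using cj(1) by (subst Min_gr_iff) auto
  have "\<forall>\<^sub>F t in at_left T. \<forall>j\<in>?V - Q. cj j \<le> boundary_dist (x j t)"
    using cj(2) by (intro eventually_ball_finite) auto
  then obtain t2 where t2: "t2 < T" and far: "\<And>t j. t2 < t \<Longrightarrow> t < T \<Longrightarrow> j \<in> ?V - Q
      \<Longrightarrow> cj j \<le> boundary_dist (x j t)"
    unfolding eventually_at_left_field by blast
  define t1 where "t1 = max t0 ((t2 + T) / 2)"
  have t1: "t1 \<in> {0..<T}" "t0 \<le> t1" "t2 < t1" using t0 t2 by (auto simp: t1_def max_def)
  have outside: "c \<le> ?h j t" if "j \<in> ?V - Q" "t \<in> {t1..<T}" for j t
  proof -
    have "c \<le> cj j" using that(1) by (auto simp: c_def intro!: Min_le)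
    also have "\<dots> \<le> ?h j t" using far[of t j] that t1 bd[of j t] by auto
    finally show ?thesis .
  qed

  \<comment> \<open>The threshold on \<open>C\<close> says exactly that the lower bound for the weighted sum is positive.\<close>
  define kap where "kap = A - a_tot * (1 - 1 / C)"
  have a_pos: "a_tot > 0"
    using assms(2,9,11) finQ QV by (auto intro!: sum_pos)
  have A_pos: "A > 0" using assms(3,10,11) QV by auto
  have A_le: "A \<le> a_tot" using assms(9,10) by (auto intro: sum_abs)
  have kap: "kap > 0"
  proof (cases "A = a_tot")
    case True
    then show ?thesis using C(1) a_pos by (simp add: kap_def algebra_simps)
  next
    case False
    then have "C < 1 / (1 - A / a_tot)" using C(2) by (simp add: ratio_threshold_def)
    moreover have "1 - A / a_tot > 0" using False A_le a_pos by simp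
    ultimately show ?thesis using C(1) a_pos by (simp add: kap_def field_simps)
  qed

  define b where "b i = sgn (\<Sum>i\<in>Q. a i) * a i" for i
  have sum_b: "(\<Sum>i\<in>Q. b i) = A"
    unfolding b_def assms(10) sum_distrib_left[symmetric] by (metis abs_sgn mult.commute)
  have abs_b: "\<bar>b i\<bar> = \<bar>a i\<bar>" for i
    using A_pos assms(10) by (auto simp: b_def abs_mult sgn_if)
  define F where "F t = (\<Sum>i\<in>Q. b i * ?h i t)" for t
  define M where "M t = Max ((\<lambda>k. ?h k t) ` Q)" for t
  have heights: "M t / C \<le> ?h i t" "?h i t \<le> M t" if "i \<in> Q" "t \<in> {t1..<T}" for i t
  proof -
    have "(\<lambda>k. boundary_dist (x k t)) ` Q = (\<lambda>k. ?h k t) ` Q"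
      using bd QV that(2) t1 by (intro image_cong) auto
    then have "M t \<le> C * Min ((\<lambda>k. ?h k t) ` Q)"
      using comp[of t] that(2) t1 by (simp add: M_def)
    also have "\<dots> \<le> C * ?h i t"
      using C(1) finQ that(1) by (intro mult_left_mono) auto
    finally show "M t / C \<le> ?h i t" using C(1) by (simp add: field_simps)
    show "?h i t \<le> M t" unfolding M_def using finQ that(1) by auto
  qed
  have F_ge: "kap * M t \<le> F t" if "t \<in> {t1..<T}" for t
  proof -
    have "((\<Sum>i\<in>Q. b i) - (\<Sum>i\<in>Q. \<bar>b i\<bar>) * (1 - 1 / C)) * M t \<le> F t"
      unfolding F_def using heights that C(1) by (intro weighted_sum_ge_Max) auto
    then show ?thesis using sum_b assms(9) by (simp add: abs_b kap_def)
  qed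
  have M_pos: "M t > 0" if "t \<in> {t1..<T}" for t
  proof -
    obtain i where i: "i \<in> Q" using assms(11) by auto
    then have "0 < ?h i t" using hpos QV that t1 by auto
    then show ?thesis using heights(2)[OF i that] by simp
  qed
  have F_le: "F t \<le> a_tot * (C * ?h i t)" if "i \<in> Q" "t \<in> {t1..<T}" for i t
  proof -
    have "F t \<le> (\<Sum>k\<in>Q. \<bar>a k\<bar> * (C * ?h i t))"
      unfolding F_def
    proof (rule sum_mono)
      fix k assume k: "k \<in> Q"
      have "b k * ?h k t \<le> \<bar>a k\<bar> * ?h k t"
        using hpos[of k t] k QV that t1 abs_b[of k] by (intro mult_right_mono) auto
      also have "?h k t \<le> C * ?h i t"
        using heights(2)[OF k that(2)] heights(1)[OF that] C(1) by (simp add: field_simps)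
      finally show "b k * ?h k t \<le> \<bar>a k\<bar> * (C * ?h i t)" by (simp add: mult_left_mono)
    qed
    then show ?thesis by (simp add: assms(9) sum_distrib_right)
  qed

  define F' where "F' t = (\<Sum>i\<in>Q. b i * (\<Sum>j\<in>?V - Q. a j * lift_kernel (x i t) (x j t)))" for t
  have derF: "(F has_real_derivative F' t) (at t within {0..<T})" if t: "t \<in> {0..<T}" for t
  proof -
    let ?g = "\<lambda>i j. lift_kernel (x i t) (x j t)"
    have exchange: "(\<Sum>i\<in>Q. a i * (\<Sum>j\<in>?V. a j * ?g i j)) = (\<Sum>i\<in>Q. a i * (\<Sum>j\<in>?V - Q. a j * ?g i j))"
      by (rule sum_antisymmetric_exchange[OF _ QV lift_kernel_antisym]) simp
    have "(F has_real_derivative (\<Sum>i\<in>Q. b i * (\<Sum>j\<in>?V. a j * ?g i j))) (at t within {0..<T})"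
      unfolding F_def
    proof (rule DERIV_sum)
      fix i assume "i \<in> Q"
      then have "i \<in> ?V" using QV by blast
      then show "((\<lambda>s. b i * ?h i s) has_real_derivative b i * (\<Sum>j\<in>?V. a j * ?g i j))
          (at t within {0..<T})"
        by (rule DERIV_cmult[OF height_has_derivative[OF sol t]])
    qed
    moreover have "(\<Sum>i\<in>Q. b i * (\<Sum>j\<in>?V. a j * ?g i j)) = F' t"
      unfolding F'_def b_def mult.assoc sum_distrib_left[of "sgn _", symmetric] exchange ..
    ultimately show ?thesis by (simp only:)
  qed

  define K where "K = (\<Sum>i\<in>Q. \<bar>a i\<bar> * (\<Sum>j\<in>?V - Q. \<bar>a j\<bar> * (8 / c\<^sup>2)))"
  have K0: "K \<ge> 0" unfolding K_def by (intro sum_nonneg mult_nonneg_nonneg) auto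
  define e where "e = kap * (c / 2)"
  have e0: "e > 0" using kap c0 by (simp add: e_def)
  have ineq: "- (K / kap) * F t \<le> F' t" if t: "t \<in> {t1..<T}" and small: "F t < e" for t
  proof -
    have "kap * M t < kap * (c / 2)" using F_ge[OF t] small by (simp add: e_def)
    then have Mc: "M t < c / 2" using kap by simp
    have kernel: "\<bar>lift_kernel (x i t) (x j t)\<bar> \<le> 8 / c\<^sup>2 * M t" if "i \<in> Q" "j \<in> ?V - Q" for i j
    proof -
      have "\<bar>lift_kernel (x i t) (x j t)\<bar> \<le> 8 / c\<^sup>2 * ?h i t"
        using hp[of i t] that QV t t1 heights(2)[OF that(1) t] Mc outside[OF that(2) t] c0
        by (intro lift_kernel_bound) auto
      also have "\<dots> \<le> 8 / c\<^sup>2 * M t"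
        using heights(2)[OF that(1) t] by (intro mult_left_mono) auto
      finally show ?thesis .
    qed
    have "\<bar>F' t\<bar> \<le> (\<Sum>i\<in>Q. \<bar>a i\<bar> * (\<Sum>j\<in>?V - Q. \<bar>a j\<bar> * (8 / c\<^sup>2 * M t)))"
      unfolding F'_def
    proof (rule order_trans[OF sum_abs], rule sum_mono)
      fix i assume i: "i \<in> Q"
      have "\<bar>\<Sum>j\<in>?V - Q. a j * lift_kernel (x i t) (x j t)\<bar>
          \<le> (\<Sum>j\<in>?V - Q. \<bar>a j\<bar> * (8 / c\<^sup>2 * M t))"
        using kernel[OF i] by (intro order_trans[OF sum_abs] sum_mono) (auto simp only: abs_mult intro!: mult_left_mono)
      then show "\<bar>b i * (\<Sum>j\<in>?V - Q. a j * lift_kernel (x i t) (x j t))\<bar>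
          \<le> \<bar>a i\<bar> * (\<Sum>j\<in>?V - Q. \<bar>a j\<bar> * (8 / c\<^sup>2 * M t))"
        unfolding abs_mult abs_b by (intro mult_left_mono) auto
    qed
    also have "\<dots> = K * M t"
      by (simp add: K_def sum_distrib_right sum_distrib_left mult.assoc)
    also have "\<dots> \<le> K * (F t / kap)"
      using F_ge[OF t] kap K0 by (intro mult_left_mono) (auto simp: field_simps)
    finally have "\<bar>F' t\<bar> \<le> K / kap * F t" by simp
    then show ?thesis by simp
  qed

  \<comment> \<open>A lower bound for \<open>F\<close> that is uniform in time, since the time interval is bounded.\<close>
  define m where "m = min (F t1) e * exp (- (K / kap) * (T - t1))"
  have F1: "F t1 > 0"
    using F_ge[of t1] mult_pos_pos[OF kap M_pos[of t1]] t1 by simp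
  have m0: "m > 0" using F1 e0 by (simp add: m_def)
  have lower: "m \<le> F t" if t: "t \<in> {t1..<T}" for t
  proof -
    have "K / kap * (t - t1) \<le> K / kap * (T - t1)"
      using t K0 kap by (intro mult_left_mono) auto
    then have "m \<le> min (F t1) e * exp (- (K / kap) * (t - t1))"
      unfolding m_def using F1 e0 by (intro mult_left_mono) simp_all
    also have "\<dots> \<le> F t"
    proof (rule gronwall_below_level)
      show "(F has_real_derivative F' s) (at s within {t1..t})" if "s \<in> {t1..t}" for s
        using that t t1 by (intro DERIV_subset[OF derF]) auto
      show "- (K / kap) * F s \<le> F' s" if "s \<in> {t1..t}" "F s < e" for s
        using that t by (intro ineq) auto
    qed (use t K0 kap e0 in auto)
    finally show ?thesis .
  qed

  obtain i where i: "i \<in> Q" using assms(11) by auto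
  define d where "d = m / (a_tot * C)"
  have d0: "d > 0" using m0 a_pos C(1) by (simp add: d_def)
  have "\<forall>\<^sub>F t in at_left T. t1 < t \<and> t < T"
    using t1 by (auto simp: eventually_at_left_field)
  then have "\<forall>\<^sub>F t in at_left T. ereal d \<le> ereal (boundary_dist (x i t))"
  proof (rule eventually_mono)
    fix t assume "t1 < t \<and> t < T"
    then have t: "t \<in> {t1..<T}" by simp
    have "m \<le> a_tot * C * ?h i t" using lower[OF t] F_le[OF i t] by (simp add: mult.assoc)
    then have "d \<le> ?h i t"
      using a_pos C(1) by (simp add: d_def pos_divide_le_eq mult.commute)
    then show "ereal d \<le> ereal (boundary_dist (x i t))" using bd[of i t] i QV t t1 by auto
  qed
  then have "ereal d \<le> Liminf (at_left T) (\<lambda>t. ereal (boundary_dist (x i t)))"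
    by (rule Liminf_bounded)
  moreover have "Liminf (at_left T) (\<lambda>t. ereal (boundary_dist (x i t))) = 0"
    using i assms(8) by (simp add: boundary_vortices_def)
  ultimately show False using d0 by simp
qed

end
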